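(* Let $\gamma:I\to\mathbb{R}^3$ be a smooth unit-speed curve with curvature $\kappa>0$ and torsion $\tau$, let $\theta_0\in\mathbb{R}$ be such that $S_T(s)=\kappa(s)\cos\left(\int_0^s\tau(u)\,du+\theta_0\right)\ne0$ for all $s\in I$, and let $J(\gamma)=J(\gamma)(\cdot,\theta_0)$. Then, for every integer $k\ge0$, $\gamma$ is a $k$-slant curve if and only if $J(\gamma)$ is a $(k+1)$-slant curve. Moreover: (i) $\gamma$ is a planar curve if and only if $J(\gamma)$ is a general helix; (ii) $\gamma$ is a general helix if and only if $J(\gamma)$ is a slant curve.
   Context: $I\subseteq\mathbb{R}$ is an open interval containing $0$. The curve $J(\gamma)$: with $S_T(s)=\kappa(s)\cos\left(\int_0^s\tau(u)\,du+\theta_0\right)$, the constant of integration can be chosen so that $\int S_T(s)\gamma'(s)\,ds$ has norm $1$ for all $s$. $J(\gamma)(\cdot,\theta_0)=\beta$ is a unit-speed curve with $\beta'(s)=\int S_T(s)\gamma'(s)\,ds$ for such a choice; thus $\beta''(s)=S_T(s)\gamma'(s)$ and $\|\beta'(s)\|=1$. $k$-slant curves: for a regular curve $\alpha$ put $\psi_1=\alpha'/\|\alpha'\|$ and $\psi_{j+1}=\psi_j'/\|\psi_j'\|$ for $j\ge1$ (as long as $\psi_j'$ never vanishes). The curve $\alpha$ is $k$-slant if $\psi_1,\dots,\psi_{k+1}$ are defined and $\psi_{k+1}$ makes a constant angle with some fixed nonzero vector. A general helix is a $0$-slant curve (its tangent makes a constant angle with a fixed direction), and a slant curve (slant helix)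 is a $1$-slant curve (its principal normal makes a constant angle with a fixed direction). *)

theory Defs
  imports "HOL-Analysis.Analysis"
begin

definition vderiv :: "(real \<Rightarrow> 'a::real_normed_vector) \<Rightarrow> real \<Rightarrow> 'a" where
  "vderiv f = (\<lambda>s. vector_derivative f (at s))"

definition smooth_curve :: "real set \<Rightarrow> (real \<Rightarrow> 'a::real_normed_vector) \<Rightarrow> bool" where
  "smooth_curve I f \<longleftrightarrow> (\<forall>n. \<forall>s\<in>I. (vderiv ^^ n) f differentiable (at s))"

definition regular_curve :: "real set \<Rightarrow> (real \<Rightarrow> 'a::real_normed_vector) \<Rightarrow> bool" where
  "regular_curve I f \<longleftrightarrow> (\<forall>s\<in>I. f differentiable (at s) \<and> vderiv f s \<noteq> 0)"

definition unit_speed :: "real set \<Rightarrow> (real \<Rightarrow> 'a::real_normed_vector) \<Rightarrow> bool" where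
  "unit_speed I f \<longleftrightarrow> (\<forall>s\<in>I. f differentiable (at s) \<and> norm (vderiv f s) = 1)"

(* Frenet apparatus of a unit-speed curve; the sign of the torsion is the one for which
   B' = - torsion * N. *)

definition tangent :: "(real \<Rightarrow> real^3) \<Rightarrow> real \<Rightarrow> real^3" where
  "tangent \<gamma> = vderiv \<gamma>"

definition curvature :: "(real \<Rightarrow> real^3) \<Rightarrow> real \<Rightarrow> real" where
  "curvature \<gamma> s = norm (vderiv (tangent \<gamma>) s)"

definition principal_normal :: "(real \<Rightarrow> real^3) \<Rightarrow> real \<Rightarrow> real^3" where
  "principal_normal \<gamma> s = vderiv (tangent \<gamma>) s /\<^sub>R curvature \<gamma> s"

definition binormal :: "(real \<Rightarrow> real^3) \<Rightarrow> real \<Rightarrow> real^3" where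
  "binormal \<gamma> s = cross3 (tangent \<gamma> s) (principal_normal \<gamma> s)"

definition torsion :: "(real \<Rightarrow> real^3) \<Rightarrow> real \<Rightarrow> real" where
  "torsion \<gamma> s = - (vderiv (binormal \<gamma>) s \<bullet> principal_normal \<gamma> s)"

(* The interval integral is oriented, so it has the usual sign for s < 0. *)

definition S_T :: "(real \<Rightarrow> real^3) \<Rightarrow> real \<Rightarrow> real \<Rightarrow> real" where
  "S_T \<gamma> \<theta>\<^sub>0 s = curvature \<gamma> s * cos ((LBINT u=ereal 0..ereal s. torsion \<gamma> u) + \<theta>\<^sub>0)"

(* J(\<gamma>) is determined only up to the constants of integration, so it is rendered as a
   predicate: X is an antiderivative of S_T \<gamma>' on I whose constant of integration makes it
   a field of unit vectors, and \<beta> is a curve with \<beta>' = X.  Existence of such curves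
   is is_J_exists below. *)

definition is_J :: "real set \<Rightarrow> (real \<Rightarrow> real^3) \<Rightarrow> real \<Rightarrow> (real \<Rightarrow> real^3) \<Rightarrow> bool" where
  "is_J I \<gamma> \<theta>\<^sub>0 \<beta> \<longleftrightarrow>
     (\<exists>X. \<forall>s\<in>I. (X has_vector_derivative S_T \<gamma> \<theta>\<^sub>0 s *\<^sub>R vderiv \<gamma> s) (at s) \<and>
                norm (X s) = 1 \<and>
                (\<beta> has_vector_derivative X s) (at s))"


lemma has_vector_derivative_vderiv:
  "f differentiable (at s) \<Longrightarrow> (f has_vector_derivative vderiv f s) (at s)"
  by (simp add: vderiv_def vector_derivative_works)

lemma has_vector_derivative_cross3:
  fixes f g :: "real \<Rightarrow> real^3"
  assumes "(f has_vector_derivative f') (at s)" "(g has_vector_derivative g') (at s)"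
  shows "((\<lambda>x. cross3 (f x) (g x)) has_vector_derivative cross3 (f s) g' + cross3 f' (g s)) (at s)"
proof -
  have "bounded_bilinear cross3"
    using bilinear_cross by (simp add: bilinear_conv_bounded_bilinear)
  then show ?thesis
    using assms by (rule bounded_bilinear.has_vector_derivative)
qed

lemma inner_derivative_const:
  fixes f g :: "real \<Rightarrow> 'a::real_inner"
  assumes "open I" "s \<in> I" "\<And>x. x \<in> I \<Longrightarrow> f x \<bullet> g x = c"
    and "(f has_vector_derivative f') (at s)" "(g has_vector_derivative g') (at s)"
  shows "f s \<bullet> g' + f' \<bullet> g s = 0"
proof -
  have "((\<lambda>x. f x \<bullet> g x) has_vector_derivative f s \<bullet> g' + f' \<bullet> g s) (at s)"
    using bounded_bilinear_inner assms(4,5) by (rule bounded_bilinear.has_vector_derivative)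
  moreover have "((\<lambda>x. f x \<bullet> g x) has_vector_derivative 0) (at s)"
    by (rule has_vector_derivative_transform_within_open[OF _ assms(1,2)])
       (use assms(3) in auto)
  ultimately show ?thesis by (rule vector_derivative_unique_at)
qed

lemma antiderivative_LBINT:
  fixes f :: "real \<Rightarrow> 'a::euclidean_space"
  assumes I: "open I" "is_interval I" "0 \<in> I" "s \<in> I" and f: "continuous_on I f"
  shows "((\<lambda>u. LBINT y=ereal 0..ereal u. f y) has_vector_derivative f s) (at s)"
proof -
  obtain d where d: "d > 0" "cball s d \<subseteq> I"
    using I open_contains_cball by blast
  define a b where "a = min 0 (s - d)" and "b = max 0 (s + d)"
  have "s - d \<in> I" "s + d \<in> I" using d by (auto simp: dist_real_def subset_iff)
  then have "a \<in> I" "b \<in> I" using I by (auto simp: a_def b_def min_def max_def)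
  then have ab: "{a..b} \<subseteq> I"
    using mem_is_interval_1_I[OF I(2)] by (meson atLeastAtMost_iff subsetI)
  have "((\<lambda>u. LBINT y=ereal 0..ereal u. f y) has_vector_derivative f s) (at s within {a..b})"
    by (rule interval_integral_FTC2)
       (use d continuous_on_subset[OF f ab] in \<open>auto simp: a_def b_def\<close>)
  then have "((\<lambda>u. LBINT y=ereal 0..ereal u. f y) has_vector_derivative f s) (at s within {a<..<b})"
    by (rule has_vector_derivative_within_subset) auto
  moreover have "s \<in> {a<..<b}" using d by (auto simp: a_def b_def)
  ultimately show ?thesis
    by (simp only: has_vector_derivative_within_open[OF _ open_greaterThanLessThan])
qed

lemma orthonormal_expansion3:
  fixes t n v :: "real^3"
  assumes "norm t = 1" "norm n = 1" "t \<bullet> n = 0"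
  shows "v = (v \<bullet> t) *\<^sub>R t + (v \<bullet> n) *\<^sub>R n + (v \<bullet> cross3 t n) *\<^sub>R cross3 t n"
    and "cross3 (cross3 t n) t = n" and "cross3 n (cross3 t n) = t"
    and "norm (cross3 t n) = 1"
proof -
  have tt: "t \<bullet> t = 1" and nn: "n \<bullet> n = 1" and nt: "n \<bullet> t = 0"
    using assms by (auto simp: norm_eq_1 inner_commute)
  let ?b = "cross3 t n"
  show B: "cross3 n ?b = t"
    using assms nn nt by (simp add: Lagrange)
  have "cross3 ?b t = - cross3 t ?b" by (rule cross_skew)
  then show A: "cross3 ?b t = n"
    using assms tt by (simp add: Lagrange)
  have "(norm ?b)\<^sup>2 = 1" using assms by (simp add: norm_cross)
  then show C: "norm ?b = 1"
    using norm_ge_zero[of ?b] by (auto simp: power2_eq_1_iff)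
  have bb: "?b \<bullet> ?b = 1" using C by (simp add: norm_eq_1)
  have bo: "?b \<bullet> t = 0" "?b \<bullet> n = 0" "t \<bullet> ?b = 0" "n \<bullet> ?b = 0"
    by (simp_all add: dot_cross_self)
  define d where "d = v - ((v \<bullet> t) *\<^sub>R t + (v \<bullet> n) *\<^sub>R n + (v \<bullet> ?b) *\<^sub>R ?b)"
  have "d \<bullet> t = 0" "d \<bullet> n = 0" "d \<bullet> ?b = 0"
    using assms tt nn nt bb bo by (simp_all add: d_def inner_diff_left inner_add_left)
  moreover from this have "cross3 d ?b = 0" by (simp add: Lagrange)
  ultimately have "d = 0"
    using norm_cross_dot[of d ?b] C by simp
  then show "v = (v \<bullet> t) *\<^sub>R t + (v \<bullet> n) *\<^sub>R n + (v \<bullet> ?b) *\<^sub>R ?b"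
    by (simp add: d_def)
qed

(* The constant of integration in the construction of J can be chosen as required:
   X = - cos phi N + sin phi B with phi' = torsion is an admissible antiderivative. *)

lemma is_J_exists:
  assumes I: "open I" "is_interval I" "0 \<in> I"
    and smooth: "smooth_curve I \<gamma>" and unit: "unit_speed I \<gamma>"
    and curv: "\<forall>s\<in>I. curvature \<gamma> s > 0"
  shows "\<exists>\<beta>. is_J I \<gamma> \<theta>\<^sub>0 \<beta>"
proof -
  define T where "T = tangent \<gamma>"
  define T1 where "T1 = vderiv T"
  define T2 where "T2 = vderiv T1"
  define \<kappa> where "\<kappa> = curvature \<gamma>"
  define N where "N = principal_normal \<gamma>"
  define B where "B = binormal \<gamma>"
  define \<tau> where "\<tau> = torsion \<gamma>"
  have sm: "(vderiv ^^ n) \<gamma> differentiable (at s)" if "s \<in> I" for n s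
    using smooth that by (simp add: smooth_curve_def)
  have dT: "(T has_vector_derivative T1 s) (at s)" if "s \<in> I" for s
    using has_vector_derivative_vderiv[OF sm[OF that, of 1]] by (simp add: T_def T1_def tangent_def)
  have dT1: "(T1 has_vector_derivative T2 s) (at s)" if "s \<in> I" for s
    using has_vector_derivative_vderiv[OF sm[OF that, of 2]]
    by (simp add: T_def T1_def T2_def tangent_def numeral_2_eq_2)
  have contT2: "continuous_on I T2"
    using sm[of _ 3]
    by (intro continuous_at_imp_continuous_on ballI differentiable_imp_continuous_within)
       (simp add: T_def T1_def T2_def tangent_def numeral_3_eq_3)
  have contT1: "continuous_on I T1" and contT: "continuous_on I T"
    using dT dT1
    by (auto intro!: continuous_at_imp_continuous_on has_vector_derivative_continuous)
  have nT: "norm (T s) = 1" if "s \<in> I" for s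
    using unit that by (simp add: unit_speed_def T_def tangent_def)
  have \<kappa>: "\<kappa> s = norm (T1 s)" for s by (simp add: \<kappa>_def curvature_def T1_def T_def)
  have \<kappa>0: "\<kappa> s > 0" if "s \<in> I" for s using curv that by (simp add: \<kappa>_def)
  have N: "N s = T1 s /\<^sub>R \<kappa> s" for s
    by (simp add: N_def principal_normal_def \<kappa>_def T1_def T_def)
  have T1: "T1 s = \<kappa> s *\<^sub>R N s" if "s \<in> I" for s using \<kappa>0[OF that] by (simp add: N)
  have B: "B s = cross3 (T s) (N s)" for s by (simp add: B_def binormal_def T_def N_def)
  have B_eq: "B = (\<lambda>s. cross3 (T s) (N s))" using B by auto
  have nN: "norm (N s) = 1" if "s \<in> I" for s using \<kappa>0[OF that] by (simp add: N \<kappa>)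
  have TT1: "T s \<bullet> T1 s = 0" if "s \<in> I" for s
    using inner_derivative_const[OF I(1) that, of T T 1, OF _ dT dT] nT that
    by (simp add: norm_eq_1 inner_commute)
  have TN: "T s \<bullet> N s = 0" if "s \<in> I" for s using TT1[OF that] by (simp add: N)
  note frame = orthonormal_expansion3[OF nT nN TN, folded B]
  define N1 where "N1 s = T2 s /\<^sub>R \<kappa> s - ((T1 s \<bullet> T2 s) / \<kappa> s ^ 3) *\<^sub>R T1 s" for s
  have dN: "(N has_vector_derivative N1 s) (at s)" if s: "s \<in> I" for s
  proof -
    have nz: "T1 s \<noteq> 0" using \<kappa>0[OF s] by (auto simp: \<kappa>)
    have "((\<lambda>s. norm (T1 s)) has_derivative (\<lambda>h. (h *\<^sub>R T2 s) \<bullet> sgn (T1 s))) (at s)"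
      using dT1[OF s] has_derivative_norm[OF nz] unfolding has_vector_derivative_def
      by (rule has_derivative_compose)
    moreover have "(\<lambda>h. (h *\<^sub>R T2 s) \<bullet> sgn (T1 s)) = (*) ((T1 s \<bullet> T2 s) / \<kappa> s)"
      by (rule ext) (simp add: sgn_div_norm \<kappa> inner_commute[of "T2 s"] field_class.field_divide_inverse)
    ultimately have "(\<kappa> has_field_derivative (T1 s \<bullet> T2 s) / \<kappa> s) (at s)"
      unfolding \<kappa>[abs_def] has_field_derivative_def by simp
    then have "((\<lambda>s. inverse (\<kappa> s)) has_field_derivative
        - (inverse (\<kappa> s) * ((T1 s \<bullet> T2 s) / \<kappa> s) * inverse (\<kappa> s))) (at s)"
      using \<kappa>0[OF s] by (intro DERIV_inverse') auto
    from has_vector_derivative_scaleR[OF this dT1[OF s]]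
    have "((\<lambda>s. inverse (\<kappa> s) *\<^sub>R T1 s) has_vector_derivative N1 s) (at s)"
      by (simp add: N1_def field_simps power3_eq_cube)
    then show ?thesis by (simp add: N[abs_def])
  qed
  have contN: "continuous_on I N"
    using dN by (auto intro!: continuous_at_imp_continuous_on has_vector_derivative_continuous)
  have cont\<kappa>: "continuous_on I \<kappa>" unfolding \<kappa>[abs_def] by (intro continuous_intros contT1)
  have contN1: "continuous_on I N1"
    unfolding N1_def[abs_def]
    by (intro continuous_intros contT1 contT2 cont\<kappa>) (use \<kappa>0 in force)+
  have dB0: "(B has_vector_derivative cross3 (T s) (N1 s)) (at s)" if "s \<in> I" for s
    using has_vector_derivative_cross3[OF dT[OF that] dN[OF that]] T1[OF that]
    by (simp add: B_eq cross_mult_left)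
  have vB: "vderiv B s = cross3 (T s) (N1 s)" if "s \<in> I" for s
    using dB0[OF that] by (simp add: vderiv_def vector_derivative_at)
  have \<tau>: "\<tau> s = - (cross3 (T s) (N1 s) \<bullet> N s)" if "s \<in> I" for s
    using vB[OF that] by (simp add: \<tau>_def torsion_def B_def N_def)
  have cont\<tau>: "continuous_on I \<tau>"
  proof -
    have "continuous_on I (\<lambda>s. - (cross3 (T s) (N1 s) \<bullet> N s))"
      by (intro continuous_intros continuous_on_cross contT contN contN1)
    then show ?thesis using \<tau> by (simp cong: continuous_on_cong)
  qed
  have dB: "(B has_vector_derivative - \<tau> s *\<^sub>R N s) (at s)" if s: "s \<in> I" for s
  proof -
    let ?B' = "cross3 (T s) (N1 s)"
    have "?B' \<bullet> T s = 0" by (simp add: dot_cross_self)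
    moreover have "B s \<bullet> ?B' + ?B' \<bullet> B s = 0"
      by (rule inner_derivative_const[OF I(1) s _ dB0[OF s] dB0[OF s]])
         (use frame(4) in \<open>simp add: norm_eq_1\<close>)
    ultimately have "?B' = - \<tau> s *\<^sub>R N s"
      using frame(1)[OF s s s, of ?B'] \<tau>[OF s] by (simp add: inner_commute)
    then show ?thesis using dB0[OF s] by simp
  qed
  have dN': "(N has_vector_derivative \<tau> s *\<^sub>R B s - \<kappa> s *\<^sub>R T s) (at s)" if s: "s \<in> I" for s
  proof -
    have NB: "cross3 (N s) (T s) = - B s"
      using cross_skew[of "N s" "T s"] by (simp add: B)
    have BN: "cross3 (B s) (N s) = - T s"
      using cross_skew[of "B s" "N s"] frame(3)[OF s s s] by simp
    have "((\<lambda>x. cross3 (B x) (T x)) has_vector_derivative \<tau> s *\<^sub>R B s - \<kappa> s *\<^sub>R T s) (at s)"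
      using has_vector_derivative_cross3[OF dB[OF s] dT[OF s]] T1[OF s]
      by (simp add: cross_mult_left cross_mult_right NB BN)
    then show ?thesis
      by (rule has_vector_derivative_transform_within_open[OF _ I(1) s]) (use frame(2) in auto)
  qed
  define \<phi> where "\<phi> s = (LBINT u=ereal 0..ereal s. \<tau> u) + \<theta>\<^sub>0" for s
  have d\<phi>: "(\<phi> has_field_derivative \<tau> s) (at s)" if "s \<in> I" for s
    using antiderivative_LBINT[OF I that cont\<tau>]
    unfolding \<phi>_def[abs_def] has_real_derivative_iff_has_vector_derivative
    by (auto intro!: derivative_eq_intros)
  define X where "X s = sin (\<phi> s) *\<^sub>R B s - cos (\<phi> s) *\<^sub>R N s" for s
  have dX: "(X has_vector_derivative S_T \<gamma> \<theta>\<^sub>0 s *\<^sub>R vderiv \<gamma> s) (at s)" if s: "s \<in> I" for s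
  proof -
    have sn: "((\<lambda>x. sin (\<phi> x)) has_field_derivative cos (\<phi> s) * \<tau> s) (at s)"
      and cs: "((\<lambda>x. cos (\<phi> x)) has_field_derivative - sin (\<phi> s) * \<tau> s) (at s)"
      using d\<phi>[OF s] by (auto intro!: derivative_eq_intros)
    have "S_T \<gamma> \<theta>\<^sub>0 s *\<^sub>R vderiv \<gamma> s = (\<kappa> s * cos (\<phi> s)) *\<^sub>R T s"
      by (simp add: S_T_def \<kappa>_def \<phi>_def \<tau>_def T_def tangent_def)
    then show ?thesis
      using has_vector_derivative_diff[OF has_vector_derivative_scaleR[OF sn dB[OF s]]
          has_vector_derivative_scaleR[OF cs dN'[OF s]]]
      unfolding X_def[abs_def] by (simp add: algebra_simps)
  qed
  have nX: "norm (X s) = 1" if s: "s \<in> I" for s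
  proof -
    have "N s \<bullet> N s = 1" "B s \<bullet> B s = 1" "N s \<bullet> B s = 0" "B s \<bullet> N s = 0"
      using nN[OF s] frame(4)[OF s s s] by (simp_all add: norm_eq_1 B dot_cross_self)
    then have "X s \<bullet> X s = (sin (\<phi> s))\<^sup>2 + (cos (\<phi> s))\<^sup>2"
      by (simp add: X_def inner_diff_left inner_diff_right power2_eq_square)
    then show ?thesis by (simp add: norm_eq_1)
  qed
  have contX: "continuous_on I X"
    using dX by (auto intro!: continuous_at_imp_continuous_on has_vector_derivative_continuous)
  have "is_J I \<gamma> \<theta>\<^sub>0 (\<lambda>s. LBINT y=ereal 0..ereal s. X y)"
    unfolding is_J_def using dX nX antiderivative_LBINT[OF I _ contX] by blast
  then show ?thesis by blast
qed

(* psi \<alpha> 0 = \<alpha>, so that psi \<alpha> 1 = \<alpha>' / norm \<alpha>' is the first of the vector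
   fields psi_1, psi_2, ... in the definition of k-slant curves. *)

definition psi :: "(real \<Rightarrow> 'a::real_normed_vector) \<Rightarrow> nat \<Rightarrow> real \<Rightarrow> 'a" where
  "psi \<alpha> j = ((\<lambda>f s. vderiv f s /\<^sub>R norm (vderiv f s)) ^^ j) \<alpha>"

definition vec_angle :: "'a::real_inner \<Rightarrow> 'a \<Rightarrow> real" where
  "vec_angle u v = arccos (u \<bullet> v / (norm u * norm v))"

(* Regularity of psi \<alpha> j for all j \<le> k says that \<alpha> is regular (j = 0) and that
   psi \<alpha> 1, ..., psi \<alpha> (k + 1) are all defined on I. *)

definition k_slant :: "real set \<Rightarrow> nat \<Rightarrow> (real \<Rightarrow> 'a::real_inner) \<Rightarrow> bool" where
  "k_slant I k \<alpha> \<longleftrightarrow>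
     (\<forall>j\<le>k. regular_curve I (psi \<alpha> j)) \<and>
     (\<exists>v c. v \<noteq> 0 \<and> (\<forall>s\<in>I. vec_angle (psi \<alpha> (k + 1) s) v = c))"

definition general_helix :: "real set \<Rightarrow> (real \<Rightarrow> 'a::real_inner) \<Rightarrow> bool" where
  "general_helix I \<alpha> \<longleftrightarrow> k_slant I 0 \<alpha>"

definition slant_curve :: "real set \<Rightarrow> (real \<Rightarrow> 'a::real_inner) \<Rightarrow> bool" where
  "slant_curve I \<alpha> \<longleftrightarrow> k_slant I 1 \<alpha>"

definition planar_curve :: "real set \<Rightarrow> (real \<Rightarrow> real^3) \<Rightarrow> bool" where
  "planar_curve I \<alpha> \<longleftrightarrow> (\<exists>n d. n \<noteq> 0 \<and> (\<forall>s\<in>I. n \<bullet> \<alpha> s = d))"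

end

theory Submission
  imports Defs
begin

text \<open>
  Write \<open>T = \<gamma>'\<close>, \<open>X = \<beta>'\<close> and \<open>S = S_T\<close>, so that \<open>X' = S T\<close> with \<open>X\<close> a field of unit vectors.
  Everything rests on one observation: the unit tangent of the curve \<open>X\<close> is \<open>T\<close> up to a sign,
  and this sign is the same on all of \<open>I\<close>.

  For the sign one needs \<open>S\<close> to be continuous.  This comes from comparing \<open>X\<close> with \<open>T\<close>:
  differentiating \<open>X \<bullet> X = 1\<close> gives \<open>S (X \<bullet> T) = 0\<close>, hence \<open>X \<bullet> T = 0\<close>, and differentiating
  once more gives \<open>S = - X \<bullet> T'\<close> (lemma \<open>unit_field_derivative_factor\<close>), which is visibly
  continuous.  Since \<open>S\<close> has no zero, it keeps its sign on the interval \<open>I\<close>.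

  Now the sequence of normalised derivatives of \<open>X\<close> agrees with that of \<open>\<gamma>\<close> up to a global sign,
  and a constant angle with \<open>v\<close> becomes a constant angle with \<open>- v\<close> when the sign is negative.
  Thus \<open>X\<close> and \<open>\<gamma>\<close> are \<open>k\<close>-slant simultaneously (lemma \<open>k_slant_unit_tangent_sign\<close>), and as \<open>X\<close> is the
  unit tangent of \<open>\<beta>\<close>, it is \<open>k\<close>-slant exactly if \<open>\<beta>\<close> is \<open>(k + 1)\<close>-slant (lemma \<open>k_slant_Suc\<close>).

  For planarity, \<open>\<gamma> \<bullet> v\<close> is constant iff \<open>T \<bullet> v = 0\<close> iff \<open>S (T \<bullet> v) = 0\<close> iff \<open>X \<bullet> v\<close> is constant iff
  the unit vectors \<open>X\<close> make a constant angle with \<open>v\<close>.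
\<close>

section \<open>Derivatives along a curve and constant angles\<close>

lemma vderiv_eqI: "(f has_vector_derivative d) (at s) \<Longrightarrow> vderiv f s = d"
  by (simp add: vderiv_def vector_derivative_at)

lemma regular_curveI:
  assumes "\<And>s. s \<in> I \<Longrightarrow> (f has_vector_derivative f' s) (at s)" "\<And>s. s \<in> I \<Longrightarrow> f' s \<noteq> 0"
  shows "regular_curve I f"
  using assms vderiv_eqI[OF assms(1)]
  by (auto simp: regular_curve_def intro: differentiableI_vector)

lemma vector_derivative_inner_left:
  assumes "(f has_vector_derivative f') (at s)"
  shows "((\<lambda>x. f x \<bullet> v) has_field_derivative f' \<bullet> v) (at s)"
  using bounded_linear.has_vector_derivative[OF bounded_linear_inner_left assms]
  by (simp add: has_real_derivative_iff_has_vector_derivative)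

lemma inner_constant_iff_derivative_orthogonal:
  fixes f :: "real \<Rightarrow> 'a::real_inner"
  assumes I: "open I" "is_interval I"
    and df: "\<And>s. s \<in> I \<Longrightarrow> (f has_vector_derivative f' s) (at s)"
  shows "(\<exists>c. \<forall>s\<in>I. f s \<bullet> v = c) \<longleftrightarrow> (\<forall>s\<in>I. f' s \<bullet> v = 0)"
proof
  assume "\<exists>c. \<forall>s\<in>I. f s \<bullet> v = c"
  then obtain c where c: "\<And>s. s \<in> I \<Longrightarrow> f s \<bullet> v = c" by blast
  show "\<forall>s\<in>I. f' s \<bullet> v = 0"
  proof
    fix s assume s: "s \<in> I"
    have "f s \<bullet> 0 + f' s \<bullet> v = 0"
      by (rule inner_derivative_const[OF I(1) s c df[OF s] has_vector_derivative_const])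
    then show "f' s \<bullet> v = 0" by simp
  qed
next
  assume "\<forall>s\<in>I. f' s \<bullet> v = 0"
  then have "((\<lambda>x. f x \<bullet> v) has_field_derivative 0) (at s within I)" if "s \<in> I" for s
    using vector_derivative_inner_left[OF df[OF that], of v] that
    by (auto intro: has_field_derivative_at_within)
  then obtain c where "\<And>s. s \<in> I \<Longrightarrow> f s \<bullet> v = c"
    using has_field_derivative_zero_constant[of I "\<lambda>x. f x \<bullet> v"] is_interval_convex[OF I(2)]
    by blast
  then show "\<exists>c. \<forall>s\<in>I. f s \<bullet> v = c" by blast
qed

lemma vec_angle_minus: "vec_angle (- u) v = vec_angle u (- v)"
  by (simp add: vec_angle_def)

lemma vec_angle_eq_iff_inner_eq:
  assumes "norm u = 1" "norm w = 1" "v \<noteq> 0"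
  shows "vec_angle u v = vec_angle w v \<longleftrightarrow> u \<bullet> v = w \<bullet> v"
proof -
  have "\<bar>x \<bullet> v / norm v\<bar> \<le> 1" if "norm x = 1" for x
    using Cauchy_Schwarz_ineq2[of x v] that assms(3) by (simp add: abs_divide divide_le_eq)
  then show ?thesis
    using assms by (simp add: vec_angle_def arccos_eq_iff)
qed

lemma constant_angle_iff_inner_constant:
  assumes "\<And>s. s \<in> I \<Longrightarrow> norm (f s) = 1" "v \<noteq> 0"
  shows "(\<exists>c. \<forall>s\<in>I. vec_angle (f s) v = c) \<longleftrightarrow> (\<exists>c. \<forall>s\<in>I. f s \<bullet> v = c)"
  using vec_angle_eq_iff_inner_eq[OF assms(1) assms(1) assms(2)] by (metis (no_types))

section \<open>Slant curves and their unit tangents\<close>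

lemma psi_0: "psi \<alpha> 0 = \<alpha>"
  by (simp add: psi_def)

lemma psi_Suc: "psi \<alpha> (Suc j) s = vderiv (psi \<alpha> j) s /\<^sub>R norm (vderiv (psi \<alpha> j) s)"
  by (simp add: psi_def)

lemma psi_psi_1: "psi (psi \<alpha> 1) j = psi \<alpha> (Suc j)"
  by (simp add: psi_def funpow_Suc_right del: funpow.simps)

text \<open>
  The unit tangent \<open>psi \<alpha> 1\<close> is a curve whose own sequence of normalised derivatives is that of
  \<open>\<alpha>\<close> shifted by one.
\<close>

lemma k_slant_Suc: "k_slant I (Suc k) \<alpha> \<longleftrightarrow> regular_curve I \<alpha> \<and> k_slant I k (psi \<alpha> 1)"
proof -
  have "(\<forall>j\<le>Suc k. regular_curve I (psi \<alpha> j)) \<longleftrightarrow>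
      regular_curve I (psi \<alpha> 0) \<and> (\<forall>j\<le>k. regular_curve I (psi \<alpha> (Suc j)))"
    by (metis Suc_le_mono le0 not0_implies_Suc)
  then show ?thesis by (simp add: k_slant_def psi_psi_1 psi_0 del: One_nat_def)
qed

text \<open>
  The normalised derivative commutes with multiplication by \<open>c = 1\<close> or \<open>c = - 1\<close>, but this can be
  claimed only where the derivative exists: the value of \<^const>\<open>vderiv\<close> at other points is
  arbitrary.  Hence regularity is carried along here and in the induction below.
\<close>

lemma regular_unit_tangent_scaleR:
  assumes I: "open I" and c: "\<bar>c\<bar> = 1"
    and eq: "\<And>s. s \<in> I \<Longrightarrow> g s = c *\<^sub>R f s"
    and f: "regular_curve I f"
  shows "regular_curve I g" "\<And>s. s \<in> I \<Longrightarrow> psi g 1 s = c *\<^sub>R psi f 1 s"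
proof -
  have dg: "(g has_vector_derivative c *\<^sub>R vderiv f s) (at s)" if "s \<in> I" for s
  proof (rule has_vector_derivative_transform_within_open[OF _ I that])
    show "((\<lambda>x. c *\<^sub>R f x) has_vector_derivative c *\<^sub>R vderiv f s) (at s)"
      using f that
      by (intro bounded_linear.has_vector_derivative[OF bounded_linear_scaleR_right]
          has_vector_derivative_vderiv) (auto simp: regular_curve_def)
  qed (simp add: eq)
  then show "regular_curve I g"
    by (rule regular_curveI) (use f c in \<open>auto simp: regular_curve_def\<close>)
  show "psi g 1 s = c *\<^sub>R psi f 1 s" if "s \<in> I" for s
    using c by (simp add: psi_Suc psi_0 vderiv_eqI[OF dg[OF that]])
qed

lemma k_slant_unit_tangent_sign_imp:
  assumes I: "open I" and c: "\<bar>c\<bar> = 1"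
    and g: "regular_curve I g"
    and eq: "\<And>s. s \<in> I \<Longrightarrow> psi g 1 s = c *\<^sub>R psi f 1 s"
    and f: "k_slant I k f"
  shows "k_slant I k g"
proof -
  have step: "regular_curve I (psi g j) \<and> (\<forall>s\<in>I. psi g (Suc j) s = c *\<^sub>R psi f (Suc j) s)"
    if "j \<le> k" for j
    using that
  proof (induction j)
    case 0
    then show ?case using g eq by (simp add: psi_0)
  next
    case (Suc j)
    have IH: "\<And>s. s \<in> I \<Longrightarrow> psi g (Suc j) s = c *\<^sub>R psi f (Suc j) s"
      using Suc by simp
    have "regular_curve I (psi f (Suc j))"
      using f Suc.prems by (simp add: k_slant_def)
    from regular_unit_tangent_scaleR[OF I c IH this] show ?case
      by (simp add: psi_Suc[abs_def] psi_0)
  qed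
  obtain v a where v: "v \<noteq> 0" "\<forall>s\<in>I. vec_angle (psi f (Suc k) s) v = a"
    using f by (auto simp: k_slant_def)
  \<comment> \<open>The sign is moved from the curve to the axis.\<close>
  have "vec_angle (psi g (Suc k) s) (c *\<^sub>R v) = a" if "s \<in> I" for s
  proof -
    have "c = 1 \<or> c = - 1" using c by linarith
    then show ?thesis
      using step[of k] v(2) that by (auto simp: vec_angle_minus)
  qed
  moreover have "c *\<^sub>R v \<noteq> 0" using v c by auto
  ultimately show ?thesis
    unfolding k_slant_def using step by (metis Suc_eq_plus1)
qed

text \<open>
  For a regular curve, being \<open>k\<close>-slant depends only on the unit tangent, and a sign that is the
  same along the whole curve can be absorbed into the axis.  The roles of the two curves are
  symmetric because \<open>c\<close> is its own inverse.
\<close>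

lemma k_slant_unit_tangent_sign:
  assumes I: "open I" and c: "\<bar>c\<bar> = 1"
    and "regular_curve I f" "regular_curve I g"
    and eq: "\<And>s. s \<in> I \<Longrightarrow> psi g 1 s = c *\<^sub>R psi f 1 s"
  shows "k_slant I k g \<longleftrightarrow> k_slant I k f"
proof -
  have "c * c = 1" using c by (metis abs_mult_self_eq mult_1)
  then have "psi f 1 s = c *\<^sub>R psi g 1 s" if "s \<in> I" for s
    using eq[OF that] by simp
  then show ?thesis
    using k_slant_unit_tangent_sign_imp[OF I c] assms(3,4) eq by blast
qed

section \<open>Unit fields with derivative along a unit tangent\<close>

text \<open>
  A unit vector field whose derivative is a nonzero multiple of \<open>T\<close> is orthogonal to \<open>T\<close>, so the
  factor can be recovered from \<open>X\<close> and \<open>T'\<close> alone.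
\<close>

lemma unit_field_derivative_factor:
  fixes X T :: "real \<Rightarrow> 'a::real_inner"
  assumes I: "open I"
    and dX: "\<And>s. s \<in> I \<Longrightarrow> (X has_vector_derivative S s *\<^sub>R T s) (at s)"
    and dT: "\<And>s. s \<in> I \<Longrightarrow> (T has_vector_derivative T' s) (at s)"
    and nX: "\<And>s. s \<in> I \<Longrightarrow> norm (X s) = 1" and nT: "\<And>s. s \<in> I \<Longrightarrow> norm (T s) = 1"
    and S: "\<And>s. s \<in> I \<Longrightarrow> S s \<noteq> 0"
    and s: "s \<in> I"
  shows "S s = - (X s \<bullet> T' s)"
proof -
  have XT: "X x \<bullet> T x = 0" if "x \<in> I" for x
    using inner_derivative_const[OF I that, of X X 1, OF _ dX[OF that] dX[OF that]]
      nX S[OF that]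
    by (auto simp: norm_eq_1 inner_commute)
  have "X s \<bullet> T' s + S s *\<^sub>R T s \<bullet> T s = 0"
    by (rule inner_derivative_const[OF I s XT dX[OF s] dT[OF s]])
  moreover have "T s \<bullet> T s = 1" using nT[OF s] by (simp add: norm_eq_1)
  ultimately show ?thesis by simp
qed

lemma continuous_nonzero_sgn_constant:
  fixes S :: "real \<Rightarrow> real"
  assumes "is_interval I" "continuous_on I S" "\<And>s. s \<in> I \<Longrightarrow> S s \<noteq> 0" "s \<in> I" "t \<in> I"
  shows "sgn (S s) = sgn (S t)"
proof (rule ccontr)
  assume "sgn (S s) \<noteq> sgn (S t)"
  then have "S s \<le> 0 \<and> 0 \<le> S t \<or> S t \<le> 0 \<and> 0 \<le> S s"
    using assms(3)[OF assms(4)] assms(3)[OF assms(5)] by (auto simp: sgn_if split: if_splits)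
  moreover have "is_interval (S ` I)"
    using connected_continuous_image[OF assms(2)] assms(1) by (simp add: is_interval_connected_1)
  ultimately have "0 \<in> S ` I"
    using assms(4,5) by (meson imageI mem_is_interval_1_I)
  then show False using assms(3) by auto
qed

section \<open>Slant properties of a curve and of its transform\<close>

theorem theorem4p1:
  fixes I :: "real set" and \<gamma> \<beta> :: "real \<Rightarrow> real^3" and \<theta>\<^sub>0 :: real
  assumes I: "open I" "is_interval I" "0 \<in> I"
    and smooth: "smooth_curve I \<gamma>"
    and unit: "unit_speed I \<gamma>"
    and curv: "\<forall>s\<in>I. curvature \<gamma> s > 0"
    and nz: "\<forall>s\<in>I. S_T \<gamma> \<theta>\<^sub>0 s \<noteq> 0"
    and J: "is_J I \<gamma> \<theta>\<^sub>0 \<beta>"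
  shows "(\<forall>k::nat. k_slant I k \<gamma> \<longleftrightarrow> k_slant I (k + 1) \<beta>) \<and>
         (planar_curve I \<gamma> \<longleftrightarrow> general_helix I \<beta>) \<and>
         (general_helix I \<gamma> \<longleftrightarrow> slant_curve I \<beta>)"
proof -
  define S where "S = S_T \<gamma> \<theta>\<^sub>0"
  define T where "T = vderiv \<gamma>"
  define T' where "T' = vderiv T"
  obtain X where dX: "\<And>s. s \<in> I \<Longrightarrow> (X has_vector_derivative S s *\<^sub>R T s) (at s)"
    and nX: "\<And>s. s \<in> I \<Longrightarrow> norm (X s) = 1"
    and d\<beta>: "\<And>s. s \<in> I \<Longrightarrow> (\<beta> has_vector_derivative X s) (at s)"
    using J by (auto simp: is_J_def S_def T_def)
  have S0: "S s \<noteq> 0" if "s \<in> I" for s using nz that by (simp add: S_def)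
  have sm: "(vderiv ^^ n) \<gamma> differentiable (at s)" if "s \<in> I" for n s
    using smooth that by (simp add: smooth_curve_def)
  have d\<gamma>: "(\<gamma> has_vector_derivative T s) (at s)" if "s \<in> I" for s
    using has_vector_derivative_vderiv[OF sm[OF that, of 0]] by (simp add: T_def)
  have dT: "(T has_vector_derivative T' s) (at s)" if "s \<in> I" for s
    using has_vector_derivative_vderiv[OF sm[OF that, of 1]] by (simp add: T_def T'_def)
  have contT': "continuous_on I T'"
    using sm[of _ 2]
    by (intro continuous_at_imp_continuous_on ballI differentiable_imp_continuous_within)
       (simp add: T_def T'_def numeral_2_eq_2)
  have nT: "norm (T s) = 1" if "s \<in> I" for s
    using unit that by (simp add: unit_speed_def T_def)

  have "continuous_on I X"
    using dX by (auto intro!: continuous_at_imp_continuous_on has_vector_derivative_continuous)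
  then have "continuous_on I (\<lambda>s. - (X s \<bullet> T' s))"
    by (intro continuous_intros contT')
  then have "continuous_on I S"
    using unit_field_derivative_factor[OF I(1) dX dT nX nT S0] by (simp cong: continuous_on_cong)
  from continuous_nonzero_sgn_constant[OF I(2) this S0 _ I(3)]
  have sgnS: "sgn (S s) = sgn (S 0)" if "s \<in> I" for s
    using that by blast

  have psi\<gamma>: "psi \<gamma> 1 s = T s" if "s \<in> I" for s
    using nT[OF that] by (simp add: psi_Suc psi_0 T_def)
  have psi\<beta>: "psi \<beta> 1 s = X s" if "s \<in> I" for s
    using nX[OF that] by (simp add: psi_Suc psi_0 vderiv_eqI[OF d\<beta>[OF that]])
  have dX': "(psi \<beta> 1 has_vector_derivative S s *\<^sub>R T s) (at s)" if "s \<in> I" for s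
    by (rule has_vector_derivative_transform_within_open[OF dX[OF that] I(1) that])
       (simp add: psi\<beta> del: One_nat_def)
  have reg\<gamma>: "regular_curve I \<gamma>"
    by (rule regular_curveI[OF d\<gamma>]) (use nT in force)+
  have reg\<beta>: "regular_curve I \<beta>"
    by (rule regular_curveI[OF d\<beta>]) (use nX in force)+
  have regX: "regular_curve I (psi \<beta> 1)"
    by (rule regular_curveI[OF dX']) (use nT S0 in force)+
  have tangentX: "psi (psi \<beta> 1) 1 s = sgn (S 0) *\<^sub>R psi \<gamma> 1 s" if "s \<in> I" for s
  proof -
    have "psi (psi \<beta> 1) 1 s = (S s *\<^sub>R T s) /\<^sub>R \<bar>S s\<bar>"
      using nT[OF that] vderiv_eqI[OF dX'[OF that]] psi_Suc[of "psi \<beta> 1" 0 s]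
      by (simp add: psi_0)
    also have "\<dots> = sgn (S s) *\<^sub>R T s"
      by (simp add: sgn_real_def)
    finally show ?thesis by (simp only: sgnS[OF that] psi\<gamma>[OF that])
  qed
  have "\<bar>sgn (S 0)\<bar> = 1" using S0[OF I(3)] by (simp add: abs_sgn_eq)
  from k_slant_unit_tangent_sign[OF I(1) this reg\<gamma> regX tangentX]
  have main: "k_slant I k \<gamma> \<longleftrightarrow> k_slant I (k + 1) \<beta>" for k
    using reg\<beta> by (simp add: k_slant_Suc)

  have fixed_direction: "(\<exists>d. \<forall>s\<in>I. v \<bullet> \<gamma> s = d) \<longleftrightarrow> (\<exists>c. \<forall>s\<in>I. vec_angle (psi \<beta> 1 s) v = c)"
    if "v \<noteq> 0" for v
  proof -
    have "(\<exists>d. \<forall>s\<in>I. v \<bullet> \<gamma> s = d) \<longleftrightarrow> (\<forall>s\<in>I. T s \<bullet> v = 0)"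
      using inner_constant_iff_derivative_orthogonal[OF I(1,2) d\<gamma>, of v]
      by (simp add: inner_commute)
    also have "\<dots> \<longleftrightarrow> (\<forall>s\<in>I. S s *\<^sub>R T s \<bullet> v = 0)"
      using S0 by simp
    also have "\<dots> \<longleftrightarrow> (\<exists>c. \<forall>s\<in>I. psi \<beta> 1 s \<bullet> v = c)"
      using inner_constant_iff_derivative_orthogonal[OF I(1,2) dX', of v] by blast
    also have "\<dots> \<longleftrightarrow> (\<exists>c. \<forall>s\<in>I. vec_angle (psi \<beta> 1 s) v = c)"
      by (rule constant_angle_iff_inner_constant[symmetric]) (use nX psi\<beta> that in auto)
    finally show ?thesis .
  qed
  have "planar_curve I \<gamma> \<longleftrightarrow> general_helix I \<beta>"
    using fixed_direction reg\<beta>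
    unfolding planar_curve_def general_helix_def k_slant_def by (simp add: psi_0) blast
  then show ?thesis
    using main main[of 0] by (simp add: general_helix_def slant_curve_def)
qed

end
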